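(* For any poset $P$ on $[p]$, the sequence $(\Omega_P(n))_{n\ge0}$ of values of the order polynomial of $P$ is log-concave, i.e. $\Omega_P(n)^2\ge\Omega_P(n-1)\,\Omega_P(n+1)$ for all $n\ge1$.
   Context: $[n]=\{1,2,\ldots,n\}$. Let $(P,\preceq)$ be a poset whose underlying set is $[p]$; $\preceq$ is the partial order of $P$, while $\le$ and $<$ denote the usual total order on integers. A $P$-partition with range $[n]$ is a map $f:P\to[n]$ such that for all $x\prec y$ in $P$: (1) $f(x)\le f(y)$, and (2) if $x>y$ (as integers) then $f(x)<f(y)$. $\Omega_P(n)$ is the number of $P$-partitions with range $[n]$. *)

theory Defs
  imports Main "HOL-Library.FuncSet"
begin

(* A poset on [p] is given by its order r, a relation with partial_order_on {1..p} r;
   (x, y) \<in> r means that x precedes or equals y in the poset, whereas < and \<le> are the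
   usual order of the labels. Extensional functions are used so that each map from
   [p] to [n] is represented, and hence counted, exactly once. *)

definition P_partitions :: "nat \<Rightarrow> (nat \<times> nat) set \<Rightarrow> nat \<Rightarrow> (nat \<Rightarrow> nat) set" where
  "P_partitions p r n =
     {f \<in> {1..p} \<rightarrow>\<^sub>E {1..n}.
        \<forall>x\<in>{1..p}. \<forall>y\<in>{1..p}. (x, y) \<in> r \<and> x \<noteq> y \<longrightarrow>
          f x \<le> f y \<and> (x > y \<longrightarrow> f x < f y)}"

definition order_poly :: "nat \<Rightarrow> (nat \<times> nat) set \<Rightarrow> nat \<Rightarrow> nat" where
  "order_poly p r n = card (P_partitions p r n)"

end

theory Submission
  imports Defs
begin

text \<open>
  The proof is a correlation inequality in a distributive lattice. Translating values by one does
  not affect the defining conditions of a \<open>P\<close>-partition, so only the length of the range matters: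
  the \<open>P\<close>-partitions with values in \<open>{2..n}\<close> are as many as those with range \<open>[n - 1]\<close>, and those
  with values in \<open>{2..n+1}\<close> as many as those with range \<open>[n]\<close>. The conditions, weak or strict, are
  preserved by pointwise minimum and maximum. If \<open>f\<close> takes values in \<open>{1..n+1}\<close> and \<open>g\<close> in \<open>{2..n}\<close>,
  then \<open>min f g\<close> takes values in \<open>{1..n}\<close> and \<open>max f g\<close> in \<open>{2..n+1}\<close>. The map
  \<open>(f, g) \<mapsto> (min f g, max f g)\<close> is not injective, but Daykin's inequality
  \<open>|A| |B| \<le> |A \<and> B| |A \<or> B|\<close> for finite subsets of a distributive lattice replaces injectivity and
  gives \<open>\<Omega>(n + 1) \<Omega>(n - 1) \<le> \<Omega>(n) \<Omega>(n)\<close>.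

  Daykin's inequality is the case of indicator functions in the four functions theorem of
  Ahlswede and Daykin (\<open>four_functions\<close>). That theorem is proved for the subsets of a finite set,
  by induction on the set; integer-valued functions are turned into sets by taking the
  region below their graph (\<open>subgraph\<close>), which turns minimum and maximum into intersection and
  union.
\<close>

section \<open>The four functions theorem\<close>

text \<open>
  The four functions theorem for a two-element chain. The mixed products \<open>u = a0 b1\<close> and
  \<open>v = a1 b0\<close> are both at most \<open>w = c0 d1\<close>, while \<open>u v \<le> w z\<close> for \<open>z = c1 d0\<close>. Expanding
  \<open>(w - u) (w - v) \<ge> 0\<close> gives \<open>w (u + v) \<le> w\<^sup>2 + u v \<le> w (w + z)\<close>, so \<open>u + v \<le> w + z\<close>.
\<close>

lemma four_functions_two_point:
  fixes a0 a1 b0 b1 c0 c1 d0 d1 :: "'b::linordered_idom"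
  assumes nonneg: "0 \<le> a0" "0 \<le> a1" "0 \<le> b0" "0 \<le> b1" "0 \<le> c0" "0 \<le> c1" "0 \<le> d0" "0 \<le> d1"
    and 00: "a0 * b0 \<le> c0 * d0" and 01: "a0 * b1 \<le> c0 * d1"
    and 10: "a1 * b0 \<le> c0 * d1" and 11: "a1 * b1 \<le> c1 * d1"
  shows "(a0 + a1) * (b0 + b1) \<le> (c0 + c1) * (d0 + d1)"
proof -
  define u v w z where uvwz: "u = a0 * b1" "v = a1 * b0" "w = c0 * d1" "z = c1 * d0"
  have z: "0 \<le> z" using nonneg by (simp add: uvwz)
  have uv: "u \<le> w" "v \<le> w" using 01 10 by (simp_all add: uvwz)
  have "u + v \<le> w + z"
  proof (cases "w = 0")
    case True
    then show ?thesis using uv z by simp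
  next
    case False
    then have w: "0 < w" using nonneg by (simp add: uvwz order_less_le)
    have "(a0 * b0) * (a1 * b1) \<le> (c0 * d0) * (c1 * d1)"
      using 00 11 by (rule mult_mono) (simp_all add: nonneg)
    then have "u * v \<le> w * z" by (simp add: uvwz algebra_simps)
    moreover have "0 \<le> (w - u) * (w - v)" using uv by simp
    ultimately have "w * (u + v) \<le> w * (w + z)" by (simp add: algebra_simps)
    then show ?thesis using w by simp
  qed
  then show ?thesis using 00 11 by (simp add: uvwz algebra_simps)
qed

lemma sum_Pow_insert:
  fixes f :: "'a set \<Rightarrow> 'b::comm_monoid_add"
  assumes "finite S" "x \<notin> S"
  shows "sum f (Pow (insert x S)) = (\<Sum>X\<in>Pow S. f X + f (insert x X))"
proof -
  have "inj_on (insert x) (Pow S)"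
    using assms(2) by (auto simp: inj_on_def)
  then have "sum f (insert x ` Pow S) = (\<Sum>X\<in>Pow S. f (insert x X))"
    by (simp add: sum.reindex)
  moreover have "Pow S \<inter> insert x ` Pow S = {}"
    using assms(2) by auto
  ultimately show ?thesis
    using assms(1) by (simp add: Pow_insert sum.union_disjoint sum.distrib)
qed

text \<open>
  The Ahlswede--Daykin theorem on a Boolean lattice. Summing each function over the presence or
  absence of one element \<open>x\<close> reduces the ground set, and the hypothesis survives this reduction by
  the two-point case.
\<close>

theorem four_functions:
  fixes \<alpha> \<beta> \<gamma> \<delta> :: "'a set \<Rightarrow> 'b::linordered_idom"
  assumes "finite S"
    and "\<And>X. X \<subseteq> S \<Longrightarrow> 0 \<le> \<alpha> X" "\<And>X. X \<subseteq> S \<Longrightarrow> 0 \<le> \<beta> X"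
    and "\<And>X. X \<subseteq> S \<Longrightarrow> 0 \<le> \<gamma> X" "\<And>X. X \<subseteq> S \<Longrightarrow> 0 \<le> \<delta> X"
    and "\<And>X Y. X \<subseteq> S \<Longrightarrow> Y \<subseteq> S \<Longrightarrow> \<alpha> X * \<beta> Y \<le> \<gamma> (X \<inter> Y) * \<delta> (X \<union> Y)"
  shows "sum \<alpha> (Pow S) * sum \<beta> (Pow S) \<le> sum \<gamma> (Pow S) * sum \<delta> (Pow S)"
  using assms
proof (induction S arbitrary: \<alpha> \<beta> \<gamma> \<delta> rule: finite_induct)
  case empty
  then show ?case by simp
next
  case (insert x S)
  note nonneg = insert.prems(1-4) and le = insert.prems(5)
  define \<alpha>' \<beta>' \<gamma>' \<delta>' where primed:
    "\<alpha>' = (\<lambda>X. \<alpha> X + \<alpha> (insert x X))" "\<beta>' = (\<lambda>X. \<beta> X + \<beta> (insert x X))"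
    "\<gamma>' = (\<lambda>X. \<gamma> X + \<gamma> (insert x X))" "\<delta>' = (\<lambda>X. \<delta> X + \<delta> (insert x X))"
  have "sum \<alpha>' (Pow S) * sum \<beta>' (Pow S) \<le> sum \<gamma>' (Pow S) * sum \<delta>' (Pow S)"
  proof (rule insert.IH)
    fix X Y assume XY: "X \<subseteq> S" "Y \<subseteq> S"
    then have x: "x \<notin> X" "x \<notin> Y" using insert.hyps by auto
    have sub: "X \<subseteq> insert x S" "Y \<subseteq> insert x S"
      "insert x X \<subseteq> insert x S" "insert x Y \<subseteq> insert x S"
      "X \<inter> Y \<subseteq> insert x S" "X \<union> Y \<subseteq> insert x S"
      "insert x (X \<inter> Y) \<subseteq> insert x S" "insert x (X \<union> Y) \<subseteq> insert x S"
      using XY by auto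
    have "\<alpha> X * \<beta> (insert x Y) \<le> \<gamma> (X \<inter> Y) * \<delta> (insert x (X \<union> Y))"
      using le[OF sub(1) sub(4)] x by simp
    moreover have "\<alpha> (insert x X) * \<beta> Y \<le> \<gamma> (X \<inter> Y) * \<delta> (insert x (X \<union> Y))"
      using le[OF sub(3) sub(2)] x by simp
    moreover have "\<alpha> (insert x X) * \<beta> (insert x Y)
        \<le> \<gamma> (insert x (X \<inter> Y)) * \<delta> (insert x (X \<union> Y))"
      using le[OF sub(3) sub(4)] by simp
    ultimately show "\<alpha>' X * \<beta>' Y \<le> \<gamma>' (X \<inter> Y) * \<delta>' (X \<union> Y)"
      unfolding primed
      using nonneg sub le[OF sub(1) sub(2)] by (intro four_functions_two_point) auto
  next
    fix X assume "X \<subseteq> S"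
    then have "X \<subseteq> insert x S" "insert x X \<subseteq> insert x S" by auto
    then show "0 \<le> \<alpha>' X" "0 \<le> \<beta>' X" "0 \<le> \<gamma>' X" "0 \<le> \<delta>' X"
      unfolding primed using nonneg by simp_all
  qed
  then show ?case
    using insert.hyps by (simp add: sum_Pow_insert primed)
qed

section \<open>Daykin's inequality\<close>

text \<open>The four functions theorem for the indicator functions of the four families.\<close>

corollary Daykin_sets:
  assumes "finite S" and \<A>: "\<A> \<subseteq> Pow S" and \<B>: "\<B> \<subseteq> Pow S"
  shows "card \<A> * card \<B>
    \<le> card {X \<inter> Y |X Y. X \<in> \<A> \<and> Y \<in> \<B>} * card {X \<union> Y |X Y. X \<in> \<A> \<and> Y \<in> \<B>}"
    (is "_ \<le> card ?\<C> * card ?\<D>")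
proof -
  define ind :: "'a set set \<Rightarrow> 'a set \<Rightarrow> int" where "ind = (\<lambda>\<F> X. if X \<in> \<F> then 1 else 0)"
  have count: "sum (ind \<F>) (Pow S) = int (card \<F>)" if "\<F> \<subseteq> Pow S" for \<F>
  proof -
    have "Pow S \<inter> {X. X \<in> \<F>} = \<F>" using that by auto
    then show ?thesis using \<open>finite S\<close> by (simp add: ind_def sum.If_cases)
  qed
  have "sum (ind \<A>) (Pow S) * sum (ind \<B>) (Pow S) \<le> sum (ind ?\<C>) (Pow S) * sum (ind ?\<D>) (Pow S)"
  proof (rule four_functions[OF \<open>finite S\<close>])
    show "ind \<A> X * ind \<B> Y \<le> ind ?\<C> (X \<inter> Y) * ind ?\<D> (X \<union> Y)" for X Y
    proof (cases "X \<in> \<A> \<and> Y \<in> \<B>")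
      case True
      then have "X \<inter> Y \<in> ?\<C>" "X \<union> Y \<in> ?\<D>" by blast+
      then show ?thesis by (simp add: ind_def)
    qed (auto simp: ind_def)
  qed (simp_all add: ind_def)
  moreover have "?\<C> \<subseteq> Pow S" "?\<D> \<subseteq> Pow S" using \<A> \<B> by blast+
  ultimately show ?thesis
    using \<A> \<B> by (simp only: count) (simp flip: of_nat_mult)
qed

definition subgraph :: "'a set \<Rightarrow> ('a \<Rightarrow> nat) \<Rightarrow> ('a \<times> nat) set" where
  "subgraph V f = (SIGMA x:V. {..<f x})"

lemma inj_on_subgraph: "inj_on (subgraph V) (extensional V)"
proof (rule inj_onI)
  fix f g assume fg: "f \<in> extensional V" "g \<in> extensional V" "subgraph V f = subgraph V g"
  show "f = g"
  proof (rule extensionalityI[OF fg(1,2)])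
    fix x assume "x \<in> V"
    then have "subgraph V f `` {x} = {..<f x}" "subgraph V g `` {x} = {..<g x}"
      by (auto simp: subgraph_def)
    then show "f x = g x" using fg(3) by simp
  qed
qed

lemma subgraph_min:
  "subgraph V (\<lambda>x\<in>V. min (f x) (g x)) = subgraph V f \<inter> subgraph V g"
  by (auto simp: subgraph_def)

lemma subgraph_max:
  "subgraph V (\<lambda>x\<in>V. max (f x) (g x)) = subgraph V f \<union> subgraph V g"
  by (auto simp: subgraph_def)

text \<open>
  The subgraph map embeds functions into sets as a lattice, so Daykin's inequality for
  sets carries over. Only upper bounds on the numbers of minima and of maxima are wanted, so these
  families are merely assumed to lie in \<open>H\<close> and \<open>K\<close>.
\<close>

lemma Daykin_functions:
  fixes F G H K :: "('a \<Rightarrow> nat) set"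
  assumes V: "finite V"
    and F: "finite F" "F \<subseteq> extensional V" and G: "finite G" "G \<subseteq> extensional V"
    and H: "finite H" and K: "finite K"
    and min: "\<And>f g. f \<in> F \<Longrightarrow> g \<in> G \<Longrightarrow> (\<lambda>x\<in>V. min (f x) (g x)) \<in> H"
    and max: "\<And>f g. f \<in> F \<Longrightarrow> g \<in> G \<Longrightarrow> (\<lambda>x\<in>V. max (f x) (g x)) \<in> K"
  shows "card F * card G \<le> card H * card K"
proof -
  let ?s = "subgraph V"
  let ?\<C> = "{X \<inter> Y |X Y. X \<in> ?s ` F \<and> Y \<in> ?s ` G}"
  let ?\<D> = "{X \<union> Y |X Y. X \<in> ?s ` F \<and> Y \<in> ?s ` G}"
  have "card F = card (?s ` F)" "card G = card (?s ` G)"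
    using F(2) G(2) inj_on_subgraph by (metis card_image inj_on_subset)+
  moreover have "finite (\<Union> (?s ` (F \<union> G)))"
    using V F(1) G(1) by (auto simp: subgraph_def)
  then have "card (?s ` F) * card (?s ` G) \<le> card ?\<C> * card ?\<D>"
    by (rule Daykin_sets) auto
  moreover have "?\<C> \<subseteq> ?s ` H"
    using min by (auto simp flip: subgraph_min)
  then have "card ?\<C> \<le> card H"
    using H by (meson card_image_le card_mono finite_imageI le_trans)
  moreover have "?\<D> \<subseteq> ?s ` K"
    using max by (auto simp flip: subgraph_max)
  then have "card ?\<D> \<le> card K"
    using K by (meson card_image_le card_mono finite_imageI le_trans)
  ultimately show ?thesis
    by (metis (no_types, lifting) le_trans mult_le_mono)
qed

section \<open>Partitions with values in an interval\<close>

definition P_partitions_in :: "nat \<Rightarrow> (nat \<times> nat) set \<Rightarrow> nat set \<Rightarrow> (nat \<Rightarrow> nat) set" where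
  "P_partitions_in p r I =
     {f \<in> {1..p} \<rightarrow>\<^sub>E I.
        \<forall>x\<in>{1..p}. \<forall>y\<in>{1..p}. (x, y) \<in> r \<and> x \<noteq> y \<longrightarrow>
          f x \<le> f y \<and> (x > y \<longrightarrow> f x < f y)}"

lemma order_poly_eq: "order_poly p r n = card (P_partitions_in p r {1..n})"
  by (simp add: order_poly_def P_partitions_def P_partitions_in_def)

lemma finite_P_partitions_in: "finite I \<Longrightarrow> finite (P_partitions_in p r I)"
  by (simp add: P_partitions_in_def finite_PiE)

lemma P_partitions_in_extensional: "P_partitions_in p r I \<subseteq> extensional {1..p}"
  by (auto simp: P_partitions_in_def PiE_def)

lemma card_P_partitions_in_shift:
  "card (P_partitions_in p r {Suc a..Suc b}) = card (P_partitions_in p r {a..b})"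
proof -
  let ?Q = "P_partitions_in p r {a..b}" and ?Q' = "P_partitions_in p r {Suc a..Suc b}"
  let ?up = "\<lambda>f. \<lambda>x\<in>{1..p}. Suc (f x)" and ?down = "\<lambda>f. \<lambda>x\<in>{1..p}. f x - 1"
  have pred: "Suc (f x - 1) = f x" "f x - 1 \<in> {a..b}" if "f \<in> ?Q'" "x \<in> {1..p}" for f x
  proof -
    have "f x \<in> {Suc a..Suc b}" using that by (auto simp: P_partitions_in_def)
    then show "Suc (f x - 1) = f x" "f x - 1 \<in> {a..b}" by auto
  qed
  have "bij_betw ?up ?Q ?Q'"
  proof (rule bij_betw_byWitness[where f' = ?down])
    show "\<forall>f\<in>?Q. ?down (?up f) = f"
    proof
      fix f assume "f \<in> ?Q"
      then have "f \<in> extensional {1..p}" using P_partitions_in_extensional by blast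
      then show "?down (?up f) = f" by (intro extensionalityI[of _ "{1..p}"]) simp_all
    qed
    show "\<forall>f\<in>?Q'. ?up (?down f) = f"
    proof
      fix f assume f: "f \<in> ?Q'"
      then have "f \<in> extensional {1..p}" using P_partitions_in_extensional by blast
      then show "?up (?down f) = f"
        using pred(1)[OF f] by (intro extensionalityI[of _ "{1..p}"]) simp_all
    qed
    show "?up ` ?Q \<subseteq> ?Q'"
      by (auto simp: P_partitions_in_def PiE_iff)
    show "?down ` ?Q' \<subseteq> ?Q"
    proof (rule image_subsetI)
      fix f assume f: "f \<in> ?Q'"
      have "f x - 1 \<le> f y - 1 \<and> (x > y \<longrightarrow> f x - 1 < f y - 1)"
        if xy: "x \<in> {1..p}" "y \<in> {1..p}" "(x, y) \<in> r" "x \<noteq> y" for x y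
      proof -
        have "f x \<le> f y \<and> (x > y \<longrightarrow> f x < f y)"
          using f xy by (simp add: P_partitions_in_def)
        then show ?thesis using pred(1)[OF f xy(1)] by linarith
      qed
      then show "?down f \<in> ?Q"
        using pred(2)[OF f] by (simp add: P_partitions_in_def)
    qed
  qed
  then show ?thesis by (simp add: bij_betw_same_card)
qed

lemma min_P_partition:
  assumes f: "f \<in> P_partitions_in p r I" and g: "g \<in> P_partitions_in p r J"
    and L: "\<And>i j. i \<in> I \<Longrightarrow> j \<in> J \<Longrightarrow> min i j \<in> L"
  shows "(\<lambda>x\<in>{1..p}. min (f x) (g x)) \<in> P_partitions_in p r L"
proof -
  have "min (f x) (g x) \<le> min (f y) (g y) \<and> (x > y \<longrightarrow> min (f x) (g x) < min (f y) (g y))"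
    if "x \<in> {1..p}" "y \<in> {1..p}" "(x, y) \<in> r" "x \<noteq> y" for x y
  proof -
    have "f x \<le> f y \<and> (x > y \<longrightarrow> f x < f y)" "g x \<le> g y \<and> (x > y \<longrightarrow> g x < g y)"
      using f g that by (simp_all add: P_partitions_in_def)
    then show ?thesis by linarith
  qed
  moreover have "min (f x) (g x) \<in> L" if "x \<in> {1..p}" for x
    using f g that by (intro L) (auto simp: P_partitions_in_def)
  ultimately show ?thesis by (simp add: P_partitions_in_def)
qed

lemma max_P_partition:
  assumes f: "f \<in> P_partitions_in p r I" and g: "g \<in> P_partitions_in p r J"
    and L: "\<And>i j. i \<in> I \<Longrightarrow> j \<in> J \<Longrightarrow> max i j \<in> L"
  shows "(\<lambda>x\<in>{1..p}. max (f x) (g x)) \<in> P_partitions_in p r L"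
proof -
  have "max (f x) (g x) \<le> max (f y) (g y) \<and> (x > y \<longrightarrow> max (f x) (g x) < max (f y) (g y))"
    if "x \<in> {1..p}" "y \<in> {1..p}" "(x, y) \<in> r" "x \<noteq> y" for x y
  proof -
    have "f x \<le> f y \<and> (x > y \<longrightarrow> f x < f y)" "g x \<le> g y \<and> (x > y \<longrightarrow> g x < g y)"
      using f g that by (simp_all add: P_partitions_in_def)
    then show ?thesis by linarith
  qed
  moreover have "max (f x) (g x) \<in> L" if "x \<in> {1..p}" for x
    using f g that by (intro L) (auto simp: P_partitions_in_def)
  ultimately show ?thesis by (simp add: P_partitions_in_def)
qed

section \<open>Log-concavity of the order polynomial\<close>

theorem theorem4p2:
  fixes p :: nat and r :: "(nat \<times> nat) set"
  assumes "partial_order_on {1..p} r"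
  shows "\<forall>n\<ge>1. (order_poly p r n)\<^sup>2 \<ge> order_poly p r (n - 1) * order_poly p r (n + 1)"
proof (intro allI impI)
  fix n :: nat assume n: "n \<ge> 1"
  let ?Q = "P_partitions_in p r"
  have "card (?Q {1..n+1}) * card (?Q {2..n}) \<le> card (?Q {1..n}) * card (?Q {2..n+1})"
  proof (rule Daykin_functions[where V = "{1..p}"])
    fix f g assume fg: "f \<in> ?Q {1..n+1}" "g \<in> ?Q {2..n}"
    show "(\<lambda>x\<in>{1..p}. min (f x) (g x)) \<in> ?Q {1..n}"
      using fg by (rule min_P_partition) auto
    show "(\<lambda>x\<in>{1..p}. max (f x) (g x)) \<in> ?Q {2..n+1}"
      using fg by (rule max_P_partition) auto
  qed (intro finite_P_partitions_in P_partitions_in_extensional finite_atLeastAtMost)+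
  moreover have "card (?Q {2..n}) = order_poly p r (n - 1)"
    using card_P_partitions_in_shift[of p r 1 "n - 1"] n by (simp add: order_poly_eq numeral_2_eq_2)
  moreover have "card (?Q {2..n+1}) = order_poly p r n"
    using card_P_partitions_in_shift[of p r 1 n] by (simp add: order_poly_eq numeral_2_eq_2)
  ultimately show "(order_poly p r n)\<^sup>2 \<ge> order_poly p r (n - 1) * order_poly p r (n + 1)"
    by (simp add: order_poly_eq power2_eq_square mult.commute)
qed

end
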